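(* Let $S$ be a normal complex algebraic surface without strictly log canonical singularities, with minimal log resolution $\pi: X\to S$. Let $E_0,E_1,\dots,E_{r+1}$ ($r\ge1$) be exceptional components of $\pi$ such that $E_i\cong\mathbb P^1$ for $1\le i\le r$, $E_i$ and $E_{i+1}$ intersect transversely in one point for $0\le i\le r$, the curves $E_1,\dots,E_r$ have no other intersections with exceptional components of $\pi$, and the log discrepancies of $E_0$ and $E_{r+1}$ satisfy $a_0a_{r+1}\ne0$. (The same configuration with $E_0$ absent, or with both $E_0$ and $E_{r+1}$ absent, is also allowed; for an absent curve one puts $a_0:=1$, respectively $a_{r+1}:=1$.) Let $D_r$ be the associated determinant defined in the context, considered as a Laurent polynomial in $L$ over $\mathbb Z$ with rational powers. Then: (i) all coefficients of $D_r$ are nonnegative; (ii) the constant term of $D_r$ is (strictly) positive. If moreover $a_i>0$ for all $0\le i\le r+1$, then this constant term is equal to $1$.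
   Context: The minimal log resolution $\pi:X\to S$ of the normal surface $S$ has $X$ smooth, $\pi$ proper birational, and exceptional components $E_i$, $i\in T$, smooth curves intersecting transversely (normal crossings). Log discrepancies $a_i\in\mathbb Q$ are defined by $K_X=\pi^*K_S+\sum_{i\in T}(a_i-1)E_i$, i.e. by the linear system $\sum_{i}(a_i-1)E_i\cdot E_j=2p_a(E_j)-2-E_j^2$, $j\in T$ ($p_a$ = arithmetic genus). A singularity is log terminal (resp. log canonical) if all $a_i>0$ (resp. $\ge0$) over it; strictly log canonical means log canonical but not log terminal. Definition of $D_r$. Let $-\kappa_i=E_i^2$ be the self-intersection number of $E_i$ on $X$ and $K_i:=\sum_{j=0}^{\kappa_i-1}L^{ja_i}$ for $1\le i\le r$, where $L$ is treated as an indeterminate admitting rational powers. $D_r$ is the determinant of the $r\times r$ matrix $(d_{i,j})_{1\le i,j\le r}$ with: (1) $d_{i,i}=K_i$; (2) for $i$ odd: $d_{i,i-1}=-L^{a_{i+1}}$, $d_{i,i+1}=-L^{a_{i+2}}$, $d_{i,i+2}=L^{a_{i+1}}-1$, and $d_{i,j}=0$ for $j<i-1$ and $j>i+2$; (3) for $i$ even: $d_{i,i-2}=L^{a_{i-1}}-1$, $d_{i,i-1}=-L^{a_{i-2}}$, $d_{i,i+1}=-L^{a_{i-1}}$, and $d_{i,j}=0$ for $j<i-2$ and $j>i+1$ (entries only for $1\le i,j\le r$). *)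

theory Defs
  imports
    Complex_Main
    "HOL-Library.Poly_Mapping"
    "Jordan_Normal_Form.Determinant"
begin

section \<open>Minimal log resolutions of normal surfaces\<close>

text \<open>
  Schemes and algebraic surfaces are not available, so a log resolution \<open>\<pi> : X \<rightarrow> S\<close> of a normal
  complex surface is represented by the map that it induces on closed points (the types \<open>'x\<close> and
  \<open>'s\<close>), the set \<open>T\<close> of its exceptional components, each given as a set of points of \<open>X\<close>, and the
  genus and self-intersection number of each component.  The components are smooth projective
  complex curves, so that the arithmetic genus is the genus, and being isomorphic to the projective
  line amounts to having genus 0.  As distinct components intersect transversely, their
  intersection number is the number of common points.
\<close>

definition inter :: "('x set \<Rightarrow> int) \<Rightarrow> 'x set \<Rightarrow> 'x set \<Rightarrow> int" where
  "inter selfint E F = (if E = F then selfint E else int (card (E \<inter> F)))"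

text \<open>
  The axioms below are properties of every log resolution of a normal surface: \<open>\<pi>\<close> contracts each
  component to a point and is bijective elsewhere; it has connected fibres (Zariski's main
  theorem); the exceptional components form a normal crossings divisor; their intersection matrix
  is negative definite (Mumford).
\<close>

locale log_resolution =
  fixes \<pi> :: "'x \<Rightarrow> 's"
    and T :: "'x set set"
    and genus :: "'x set \<Rightarrow> nat"
    and selfint :: "'x set \<Rightarrow> int"
  assumes surj: "surj \<pi>"
    and finite_components: "finite T"
    and contracted: "\<And>E. E \<in> T \<Longrightarrow> \<exists>s. \<pi> ` E = {s}"
    and exceptional_locus: "\<And>x y. \<pi> x = \<pi> y \<Longrightarrow> x \<noteq> y \<Longrightarrow> x \<in> \<Union>T"
    and connected_fibres: "\<And>E F. E \<in> T \<Longrightarrow> F \<in> T \<Longrightarrow> \<pi> ` E = \<pi> ` F \<Longrightarrow>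
        (E, F) \<in> {(A, B). A \<in> T \<and> B \<in> T \<and> A \<inter> B \<noteq> {}}\<^sup>*"
    and finite_inter: "\<And>E F. E \<in> T \<Longrightarrow> F \<in> T \<Longrightarrow> E \<noteq> F \<Longrightarrow> finite (E \<inter> F)"
    and no_triple_points: "\<And>E F G. E \<in> T \<Longrightarrow> F \<in> T \<Longrightarrow> G \<in> T \<Longrightarrow>
        E \<noteq> F \<Longrightarrow> F \<noteq> G \<Longrightarrow> E \<noteq> G \<Longrightarrow> E \<inter> F \<inter> G = {}"
    and negative_definite: "\<And>x :: 'x set \<Rightarrow> real. \<exists>E\<in>T. x E \<noteq> 0 \<Longrightarrow>
        (\<Sum>E\<in>T. \<Sum>F\<in>T. x E * x F * of_int (inter selfint E F)) < 0"

text \<open>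
  Minimality, in the numerical form given by Castelnuovo's criterion: contracting a component of
  genus 0 and self-intersection \<open>-1\<close> yields another log resolution exactly if that component meets
  at most two other components, and each of them in at most one point.  (If it met a component in
  two points, the image of the latter would be singular.)
\<close>

locale minimal_log_resolution = log_resolution +
  assumes minimal: "\<And>E. E \<in> T \<Longrightarrow> genus E = 0 \<Longrightarrow> selfint E = -1 \<Longrightarrow>
      card {F \<in> T - {E}. E \<inter> F \<noteq> {}} > 2 \<or> (\<exists>F\<in>T - {E}. card (E \<inter> F) > 1)"

definition log_discrepancies ::
  "'x set set \<Rightarrow> ('x set \<Rightarrow> nat) \<Rightarrow> ('x set \<Rightarrow> int) \<Rightarrow> ('x set \<Rightarrow> rat) \<Rightarrow> bool" where
  "log_discrepancies T genus selfint a \<longleftrightarrow>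
     (\<forall>F\<in>T. (\<Sum>E\<in>T. (a E - 1) * of_int (inter selfint E F))
             = 2 * of_nat (genus F) - 2 - of_int (selfint F))"

text \<open>The linear system has at most one solution, so one may speak of the log discrepancies.\<close>

lemma (in log_resolution) log_discrepancies_unique:
  assumes a: "log_discrepancies T genus selfint a"
    and b: "log_discrepancies T genus selfint b"
    and E: "E \<in> T"
  shows "a E = b E"
proof (rule ccontr)
  assume ne: "a E \<noteq> b E"
  define x :: "'x set \<Rightarrow> real" where "x = (\<lambda>F. of_rat (a F - b F))"
  have sys: "(\<Sum>G\<in>T. (a G - b G) * of_int (inter selfint G F)) = 0" if "F \<in> T" for F
  proof -
    have "(\<Sum>G\<in>T. (a G - 1) * of_int (inter selfint G F))
        = (\<Sum>G\<in>T. (b G - 1) * of_int (inter selfint G F))"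
      using a b that unfolding log_discrepancies_def by simp
    moreover have "(\<Sum>G\<in>T. (a G - b G) * of_int (inter selfint G F))
        = (\<Sum>G\<in>T. (a G - 1) * of_int (inter selfint G F))
        - (\<Sum>G\<in>T. (b G - 1) * of_int (inter selfint G F))"
      by (simp add: sum_subtractf [symmetric] algebra_simps)
    ultimately show ?thesis by simp
  qed
  have col: "(\<Sum>G\<in>T. x G * of_int (inter selfint G F)) = 0" if "F \<in> T" for F
  proof -
    have "(\<Sum>G\<in>T. x G * of_int (inter selfint G F))
        = of_rat (\<Sum>G\<in>T. (a G - b G) * of_int (inter selfint G F))"
      unfolding x_def of_rat_sum by (simp add: of_rat_mult)
    then show ?thesis using sys[OF that] by simp
  qed
  have "(\<Sum>G\<in>T. \<Sum>F\<in>T. x G * x F * of_int (inter selfint G F))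
      = (\<Sum>F\<in>T. x F * (\<Sum>G\<in>T. x G * of_int (inter selfint G F)))"
    by (subst sum.swap) (simp add: sum_distrib_left mult.assoc mult.left_commute)
  also have "\<dots> = 0" using col by simp
  finally have "(\<Sum>G\<in>T. \<Sum>F\<in>T. x G * x F * of_int (inter selfint G F)) = 0" .
  moreover have "\<exists>F\<in>T. x F \<noteq> 0" using E ne unfolding x_def by auto
  ultimately show False using negative_definite[of x] by simp
qed

definition log_terminal_at ::
  "('x \<Rightarrow> 's) \<Rightarrow> 'x set set \<Rightarrow> ('x set \<Rightarrow> rat) \<Rightarrow> 's \<Rightarrow> bool" where
  "log_terminal_at \<pi> T a s \<longleftrightarrow> (\<forall>E\<in>T. \<pi> ` E = {s} \<longrightarrow> a E > 0)"

definition log_canonical_at ::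
  "('x \<Rightarrow> 's) \<Rightarrow> 'x set set \<Rightarrow> ('x set \<Rightarrow> rat) \<Rightarrow> 's \<Rightarrow> bool" where
  "log_canonical_at \<pi> T a s \<longleftrightarrow> (\<forall>E\<in>T. \<pi> ` E = {s} \<longrightarrow> a E \<ge> 0)"

definition strictly_log_canonical_at ::
  "('x \<Rightarrow> 's) \<Rightarrow> 'x set set \<Rightarrow> ('x set \<Rightarrow> rat) \<Rightarrow> 's \<Rightarrow> bool" where
  "strictly_log_canonical_at \<pi> T a s \<longleftrightarrow> log_canonical_at \<pi> T a s \<and> \<not> log_terminal_at \<pi> T a s"


section \<open>Chains of rational exceptional components\<close>

text \<open>
  The curves that are present are the \<open>C i\<close> with \<open>lo \<le> i \<le> hi\<close>: all of \<open>C 0, \<dots>, C (r+1)\<close>, or all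
  but \<open>C 0\<close>, or all but \<open>C 0\<close> and \<open>C (r+1)\<close>.  The values of \<open>C\<close> at other indices are irrelevant.
  The curves are distinct, except that a chain with \<open>r \<ge> 2\<close> may start and end at the same component
  \<open>C 0 = C (r+1)\<close>.
\<close>

definition exceptional_chain ::
  "'x set set \<Rightarrow> ('x set \<Rightarrow> nat) \<Rightarrow> nat \<Rightarrow> nat \<Rightarrow> nat \<Rightarrow> (nat \<Rightarrow> 'x set) \<Rightarrow> bool" where
  "exceptional_chain T genus r lo hi C \<longleftrightarrow>
     r \<ge> 1 \<and> (lo, hi) \<in> {(0, r + 1), (1, r + 1), (1, r)} \<and>
     C ` {lo..hi} \<subseteq> T \<and>
     inj_on C {lo..r} \<and> inj_on C {1..hi} \<and> (r = 1 \<longrightarrow> inj_on C {lo..hi}) \<and>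
     (\<forall>i\<in>{1..r}. genus (C i) = 0) \<and>
     (\<forall>i\<in>{lo..<hi}. card (C i \<inter> C (i + 1)) = 1) \<and>
     (\<forall>i\<in>{1..r}. \<forall>F\<in>T. F \<notin> C ` ({lo..hi} \<inter> {i - 1..i + 1}) \<longrightarrow> C i \<inter> F = {})"

definition chain_discrepancy ::
  "('x set \<Rightarrow> rat) \<Rightarrow> nat \<Rightarrow> nat \<Rightarrow> (nat \<Rightarrow> 'x set) \<Rightarrow> nat \<Rightarrow> rat" where
  "chain_discrepancy a lo hi C i = (if i \<in> {lo..hi} then a (C i) else 1)"


section \<open>The determinant\<close>

text \<open>
  Laurent polynomials in \<open>L\<close> over the integers with rational powers: finitely supported functions
  from exponents to coefficients, with the convolution product.
\<close>

type_synonym laurent = "rat \<Rightarrow>\<^sub>0 int"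

definition Lpow :: "rat \<Rightarrow> laurent" where
  "Lpow q = Poly_Mapping.single q 1"

text \<open>Rows and columns are numbered from 1 here; subtraction on indices is avoided in the
  conditions, as it would be truncated.\<close>

definition D_entry :: "(nat \<Rightarrow> rat) \<Rightarrow> (nat \<Rightarrow> nat) \<Rightarrow> nat \<Rightarrow> nat \<Rightarrow> laurent" where
  "D_entry \<alpha> \<kappa> i j =
     (if j = i then \<Sum>k<\<kappa> i. Lpow (of_nat k * \<alpha> i)
      else if odd i then
        (if j + 1 = i then - Lpow (\<alpha> (i + 1))
         else if j = i + 1 then - Lpow (\<alpha> (i + 2))
         else if j = i + 2 then Lpow (\<alpha> (i + 1)) - 1
         else 0)
      else
        (if j + 2 = i then Lpow (\<alpha> (i - 1)) - 1
         else if j + 1 = i then - Lpow (\<alpha> (i - 2))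
         else if j = i + 1 then - Lpow (\<alpha> (i - 1))
         else 0))"

definition D_det :: "nat \<Rightarrow> (nat \<Rightarrow> rat) \<Rightarrow> (nat \<Rightarrow> nat) \<Rightarrow> laurent" where
  "D_det r \<alpha> \<kappa> = det (mat r r (\<lambda>(i, j). D_entry \<alpha> \<kappa> (i + 1) (j + 1)))"

end

theory Submission
  imports Defs
begin

text \<open>
  Write \<open>x_i = L^(a_i)\<close>.  The adjunction relations give \<open>x_(i-1) x_(i+1) = x_i^\<kappa>_i\<close>, and minimality
  gives \<open>\<kappa>_i \<ge> 2\<close>.  Geometrically, \<open>D_n\<close> is the sum of \<open>L^\<ell>(p)\<close> over the lattice points \<open>p\<close> of the
  half-open parallelogram spanned by \<open>v_0\<close> and \<open>v_(n+1)\<close>, where \<open>v_(i-1) + v_(i+1) = \<kappa>_i v_i\<close> and \<open>\<ell>\<close>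
  is the linear form with \<open>\<ell>(v_i) = a_i\<close>.  Passing from \<open>D_(n-1)\<close> to \<open>D_n\<close> adds the points counted by
  \<open>x_n G_n\<close>, where \<open>G_0 = D_0 = 1\<close> and
  \<open>G_n = (1 + x_n + \<dots> + x_n^(\<kappa>_n-3)) D_(n-1) + x_n^(\<kappa>_n-2) G_(n-1)\<close>.
  Since only sums and products of polynomials with nonnegative coefficients occur, positivity is
  immediate; if all \<open>a_i\<close> are positive, \<open>x_n G_n\<close> has positive exponents only.  The identity
  \<open>D_n = D_(n-1) + x_n G_n\<close> itself follows from the Laplace expansion
  \<open>D_n = K_n D_(n-1) - x_(n+1) P_(n-1)\<close> with the minors \<open>P_n = x_(n-1) D_(n-1) - (x_n - 1) P_(n-1)\<close>,
  by means of the invariant \<open>x_(n+1) P_n = x_n (D_n - G_n)\<close>.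
\<close>

section \<open>The adjunction relations along the chain\<close>

lemma (in log_resolution) selfint_neg:
  assumes E: "E \<in> T"
  shows "selfint E < 0"
proof -
  have "(\<Sum>F\<in>T. \<Sum>G\<in>T. of_bool (F = E) * of_bool (G = E) * of_int (inter selfint F G))
      = (\<Sum>F\<in>T. if F = E then (of_int (selfint E) :: real) else 0)"
  proof (rule sum.cong [OF refl])
    fix F
    have "(\<Sum>G\<in>T. of_bool (F = E) * of_bool (G = E) * of_int (inter selfint F G))
        = (\<Sum>G\<in>T. if G = E then of_bool (F = E) * (of_int (inter selfint F G) :: real) else 0)"
      by (rule sum.cong) auto
    then show "(\<Sum>G\<in>T. of_bool (F = E) * of_bool (G = E) * of_int (inter selfint F G))
        = (if F = E then (of_int (selfint E) :: real) else 0)"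
      using E finite_components by (simp add: inter_def)
  qed
  then show ?thesis
    using negative_definite [of "\<lambda>F. of_bool (F = E)"] E finite_components by auto
qed

lemma exceptional_chainD:
  assumes chain: "exceptional_chain T genus r lo hi C" and i: "i \<in> {1..r}"
  defines "N \<equiv> {lo..hi} \<inter> {i - 1, i + 1}"
  shows "C i \<in> T" "C ` N \<subseteq> T" "C i \<notin> C ` N" "inj_on C N" "genus (C i) = 0"
    and "\<And>j. j \<in> N \<Longrightarrow> card (C j \<inter> C i) = 1"
    and "\<And>F. F \<in> T \<Longrightarrow> F \<noteq> C i \<Longrightarrow> F \<notin> C ` N \<Longrightarrow> C i \<inter> F = {}"
proof -
  have bounds: "lo \<le> 1" "r \<le> hi" "hi \<le> r + 1"
    and sub: "C ` {lo..hi} \<subseteq> T"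
    and inj: "inj_on C {lo..r}" "inj_on C {1..hi}" "r = 1 \<longrightarrow> inj_on C {lo..hi}"
    and g: "\<forall>i\<in>{1..r}. genus (C i) = 0"
    and one: "\<forall>i\<in>{lo..<hi}. card (C i \<inter> C (i + 1)) = 1"
    and away: "\<forall>i\<in>{1..r}. \<forall>F\<in>T. F \<notin> C ` ({lo..hi} \<inter> {i - 1..i + 1}) \<longrightarrow> C i \<inter> F = {}"
    using chain unfolding exceptional_chain_def by auto
  have iN: "insert i N = {lo..hi} \<inter> {i - 1..i + 1}"
    using i bounds unfolding N_def by auto
  have iloc: "i \<in> {lo..hi}" using i bounds by auto
  show "C i \<in> T" "C ` N \<subseteq> T" using sub iloc unfolding N_def by auto
  show "genus (C i) = 0" using g i by blast
  have inj': "inj_on C (insert i N)"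
  proof (cases "r = 1")
    case True
    then have "inj_on C {lo..hi}" using inj by blast
    then show ?thesis unfolding iN by (rule inj_on_subset) auto
  next
    case False
    then have "insert i N \<subseteq> {lo..r} \<or> insert i N \<subseteq> {1..hi}"
      using i bounds unfolding iN by (cases "i < r") auto
    then show ?thesis using inj(1,2) inj_on_subset by blast
  qed
  have "i \<notin> N" using i unfolding N_def by auto
  then show "C i \<notin> C ` N" "inj_on C N" using inj' by auto
  show "card (C j \<inter> C i) = 1" if "j \<in> N" for j
  proof (cases "j = i + 1")
    case True
    then have "i \<in> {lo..<hi}" using that iloc unfolding N_def by auto
    then show ?thesis using one True by (simp add: Int_commute)
  next
    case False
    then have "j \<in> {lo..<hi}" "i = j + 1" using that i bounds unfolding N_def by auto
    then show ?thesis using one by simp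
  qed
  show "C i \<inter> F = {}" if "F \<in> T" "F \<noteq> C i" "F \<notin> C ` N" for F
  proof -
    have "F \<notin> C ` ({lo..hi} \<inter> {i - 1..i + 1})" using that unfolding iN [symmetric] by auto
    then show ?thesis using away i that(1) by blast
  qed
qed

lemma (in minimal_log_resolution) chain_selfint_le:
  assumes chain: "exceptional_chain T genus r lo hi C" and i: "i \<in> {1..r}"
  shows "selfint (C i) \<le> - 2"
proof -
  let ?N = "{lo..hi} \<inter> {i - 1, i + 1}"
  note ch = exceptional_chainD [OF chain i]
  have "card {F \<in> T - {C i}. C i \<inter> F \<noteq> {}} \<le> card (C ` ?N)"
    by (rule card_mono) (use ch(7) in auto)
  also have "\<dots> \<le> card ?N" by (rule card_image_le) simp
  also have "\<dots> \<le> card {i - 1, i + 1}" by (rule card_mono) auto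
  also have "\<dots> \<le> 2" by (simp add: card_insert_if)
  finally have two: "\<not> card {F \<in> T - {C i}. C i \<inter> F \<noteq> {}} > 2" by simp
  have "card (C i \<inter> F) \<le> 1" if "F \<in> T - {C i}" for F
  proof (cases "F \<in> C ` ?N")
    case True
    then obtain j where "j \<in> ?N" "F = C j" by blast
    then show ?thesis using ch(6) [of j] by (simp add: Int_commute)
  next
    case False
    then show ?thesis using ch(7) that by simp
  qed
  then have "\<not> (\<exists>F\<in>T - {C i}. card (C i \<inter> F) > 1)" by force
  then have "selfint (C i) \<noteq> - 1" using minimal [OF ch(1,5)] two by blast
  then show ?thesis using selfint_neg [OF ch(1)] by simp
qed

lemma (in log_resolution) chain_adjunction:
  assumes disc: "log_discrepancies T genus selfint a"
    and chain: "exceptional_chain T genus r lo hi C" and i: "i \<in> {1..r}"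
  defines "\<alpha> \<equiv> chain_discrepancy a lo hi C"
  shows "of_int (- selfint (C i)) * \<alpha> i = \<alpha> (i - 1) + \<alpha> (i + 1)"
proof -
  let ?N = "{lo..hi} \<inter> {i - 1, i + 1}"
  note ch = exceptional_chainD [OF chain i]
  let ?f = "\<lambda>F. (a F - 1) * of_int (inter selfint F (C i))"
  have "i \<in> {lo..hi}" using chain i unfolding exceptional_chain_def by auto
  then have ai: "\<alpha> i = a (C i)" by (simp add: \<alpha>_def chain_discrepancy_def)
  have "(\<Sum>F\<in>T. ?f F) = (\<Sum>F\<in>insert (C i) (C ` ?N). ?f F)"
  proof (rule sum.mono_neutral_right [OF finite_components])
    show "insert (C i) (C ` ?N) \<subseteq> T" using ch(1,2) by auto
    show "\<forall>F\<in>T - insert (C i) (C ` ?N). ?f F = 0"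
      using ch(7) by (auto simp: inter_def Int_commute)
  qed
  also have "\<dots> = (a (C i) - 1) * of_int (selfint (C i)) + (\<Sum>F\<in>C ` ?N. ?f F)"
    using ch(3) by (subst sum.insert) (auto simp: inter_def)
  also have "(\<Sum>F\<in>C ` ?N. ?f F) = (\<Sum>j\<in>?N. ?f (C j))"
    using ch(4) by (simp add: sum.reindex)
  also have "\<dots> = (\<Sum>j\<in>?N. \<alpha> j - 1)"
  proof (rule sum.cong [OF refl])
    fix j assume j: "j \<in> ?N"
    then have "C j \<noteq> C i" using ch(3) by auto
    then show "?f (C j) = \<alpha> j - 1"
      using ch(6) [OF j] j by (simp add: inter_def \<alpha>_def chain_discrepancy_def)
  qed
  also have "\<dots> = (\<Sum>j\<in>{i - 1, i + 1}. \<alpha> j - 1)"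
    by (rule sum.mono_neutral_left) (auto simp: \<alpha>_def chain_discrepancy_def)
  also have "\<dots> = \<alpha> (i - 1) + \<alpha> (i + 1) - 2" by simp
  finally have "(\<Sum>F\<in>T. ?f F)
      = (\<alpha> i - 1) * of_int (selfint (C i)) + (\<alpha> (i - 1) + \<alpha> (i + 1) - 2)"
    by (simp only: ai)
  moreover have "(\<Sum>F\<in>T. ?f F) = - 2 - of_int (selfint (C i))"
    using disc ch(1,5) unfolding log_discrepancies_def by simp
  ultimately show ?thesis by (simp add: algebra_simps)
qed


section \<open>Recursion for the determinant\<close>

lemma det_expand_last_column:
  fixes f :: "nat \<Rightarrow> nat \<Rightarrow> 'a :: comm_ring_1"
  assumes zero: "\<And>i. i < n \<Longrightarrow> f i (Suc n) = 0"
  shows "det (mat (Suc (Suc n)) (Suc (Suc n)) (\<lambda>(i, j). f i j))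
    = f (Suc n) (Suc n) * det (mat (Suc n) (Suc n) (\<lambda>(i, j). f i j))
      - f n (Suc n) * det (mat (Suc n) (Suc n) (\<lambda>(i, j). f (if i = n then Suc n else i) j))"
proof -
  let ?A = "mat (Suc (Suc n)) (Suc (Suc n)) (\<lambda>(i, j). f i j)"
  have "det ?A = (\<Sum>i<Suc (Suc n). ?A $$ (i, Suc n) * cofactor ?A i (Suc n))"
    by (rule laplace_expansion_column) auto
  also have "\<dots> = f n (Suc n) * cofactor ?A n (Suc n)
      + f (Suc n) (Suc n) * cofactor ?A (Suc n) (Suc n)"
    by (simp add: zero)
  also have "cofactor ?A n (Suc n)
      = - det (mat (Suc n) (Suc n) (\<lambda>(i, j). f (if i = n then Suc n else i) j))"
    unfolding cofactor_def mat_delete_def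
    by (auto intro!: arg_cong [where f = det] cong_mat simp flip: power_mult_distrib)
  also have "cofactor ?A (Suc n) (Suc n) = det (mat (Suc n) (Suc n) (\<lambda>(i, j). f i j))"
    unfolding cofactor_def mat_delete_def
    by (auto intro!: arg_cong [where f = det] cong_mat)
  finally show ?thesis by simp
qed

lemma det_mat_swap:
  "det (mat n n (\<lambda>(i, j). f j i)) = det (mat n n (\<lambda>(i, j). f i j))"
proof -
  have "mat n n (\<lambda>(i, j). f j i) = (mat n n (\<lambda>(i, j). f i j))\<^sup>T" by auto
  then show ?thesis by (simp add: det_transpose [of _ n])
qed

lemma det_expand_last_row:
  fixes f :: "nat \<Rightarrow> nat \<Rightarrow> 'a :: comm_ring_1"
  assumes zero: "\<And>j. j < n \<Longrightarrow> f (Suc n) j = 0"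
  shows "det (mat (Suc (Suc n)) (Suc (Suc n)) (\<lambda>(i, j). f i j))
    = f (Suc n) (Suc n) * det (mat (Suc n) (Suc n) (\<lambda>(i, j). f i j))
      - f (Suc n) n * det (mat (Suc n) (Suc n) (\<lambda>(i, j). f i (if j = n then Suc n else j)))"
  using det_expand_last_column [of n "\<lambda>i j. f j i", OF zero]
  by (simp only: det_mat_swap [where f = f]
      det_mat_swap [where f = "\<lambda>i j. f i (if j = n then Suc n else j)"])

text \<open>
  Up to sign, the minor of \<open>D_(n+1)\<close> that is multiplied by the entry next to the corner in the
  expansion along the last column (\<open>n\<close> odd) or row (\<open>n\<close> even).  There is none for \<open>n = 0\<close>.
\<close>

definition D_minor :: "nat \<Rightarrow> (nat \<Rightarrow> rat) \<Rightarrow> (nat \<Rightarrow> nat) \<Rightarrow> laurent" where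
  "D_minor n \<alpha> \<kappa> = (if n = 0 then 0 else
     - det (mat n n (\<lambda>(i, j). D_entry \<alpha> \<kappa>
         (if odd n \<and> i + 1 = n then n + 1 else i + 1)
         (if even n \<and> j + 1 = n then n + 1 else j + 1))))"

lemma D_det_0 [simp]: "D_det 0 \<alpha> \<kappa> = 1"
  by (simp add: D_det_def)

lemma D_minor_0 [simp]: "D_minor 0 \<alpha> \<kappa> = 0"
  by (simp add: D_minor_def)

lemma det_mat_1: "det (mat (Suc 0) (Suc 0) f) = f (0, 0)"
  by (subst det_single) auto

lemma D_minor_Suc_eq:
  "D_minor (Suc m) \<alpha> \<kappa> = - det (mat (Suc m) (Suc m) (\<lambda>(i, j). D_entry \<alpha> \<kappa>
     (Suc (if even m \<and> i = m then Suc m else i)) (Suc (if odd m \<and> j = m then Suc m else j))))"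
  unfolding D_minor_def
  by (auto intro!: arg_cong [where f = det] cong_mat arg_cong2 [where f = "D_entry \<alpha> \<kappa>"])

lemma D_det_Suc:
  "D_det (Suc n) \<alpha> \<kappa> = (\<Sum>k<\<kappa> (Suc n). Lpow (of_nat k * \<alpha> (Suc n))) * D_det n \<alpha> \<kappa>
     - Lpow (\<alpha> (Suc (Suc n))) * D_minor n \<alpha> \<kappa>"
proof (cases n)
  case 0
  then show ?thesis by (simp add: D_det_def det_mat_1 D_entry_def)
next
  case (Suc m)
  let ?d = "\<lambda>i j. D_entry \<alpha> \<kappa> (Suc i) (Suc j)"
  have det: "D_det n \<alpha> \<kappa> = det (mat n n (\<lambda>(i, j). ?d i j))" for n
    by (simp add: D_det_def)
  have corner: "?d (Suc m) (Suc m) = (\<Sum>k<\<kappa> (Suc n). Lpow (of_nat k * \<alpha> (Suc n)))"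
    by (simp add: D_entry_def Suc)
  show ?thesis
  proof (cases "even m")
    case True
    have "?d i (Suc m) = 0" if "i < m" for i
      using that True by (auto simp: D_entry_def)
    note det_expand_last_column [of m ?d, OF this]
    moreover have "?d m (Suc m) = - Lpow (\<alpha> (Suc (Suc n)))"
      using True by (simp add: D_entry_def Suc)
    ultimately show ?thesis
      using True corner by (simp only: Suc det D_minor_Suc_eq) simp
  next
    case False
    have "?d (Suc m) j = 0" if "j < m" for j
      using that False by (auto simp: D_entry_def)
    note det_expand_last_row [of m ?d, OF this]
    moreover have "?d (Suc m) m = - Lpow (\<alpha> (Suc (Suc n)))"
      using False by (simp add: D_entry_def Suc)
    ultimately show ?thesis
      using False corner by (simp only: Suc det D_minor_Suc_eq) simp
  qed
qed

lemma D_minor_Suc: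
  "D_minor (Suc n) \<alpha> \<kappa> = Lpow (\<alpha> n) * D_det n \<alpha> \<kappa>
     - (Lpow (\<alpha> (Suc n)) - 1) * D_minor n \<alpha> \<kappa>"
proof (cases n)
  case 0
  then show ?thesis by (simp add: D_minor_def det_mat_1 D_entry_def)
next
  case (Suc m)
  let ?d = "\<lambda>i j. D_entry \<alpha> \<kappa> (Suc i) (Suc j)"
  let ?s = "\<lambda>i. if i = Suc m then Suc (Suc m) else i"
  have det: "D_det n \<alpha> \<kappa> = det (mat n n (\<lambda>(i, j). ?d i j))" for n
    by (simp add: D_det_def)
  show ?thesis
  proof (cases "even m")
    case True
    have "?d i (?s (Suc m)) = 0" if "i < m" for i
      using that by (auto simp: D_entry_def)
    note det_expand_last_column [of m "\<lambda>i j. ?d i (?s j)", OF this]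
    moreover have "?d (Suc m) (?s (Suc m)) = - Lpow (\<alpha> n)"
      using True by (simp add: D_entry_def Suc)
    moreover have "?d m (?s (Suc m)) = Lpow (\<alpha> (Suc n)) - 1"
      using True by (simp add: D_entry_def Suc)
    moreover have "mat (Suc m) (Suc m) (\<lambda>(i, j). ?d i (?s j))
        = mat (Suc m) (Suc m) (\<lambda>(i, j). ?d i j)"
      by (rule cong_mat) auto
    moreover have "mat (Suc m) (Suc m) (\<lambda>(i, j). ?d (if i = m then Suc m else i) (?s j))
        = mat (Suc m) (Suc m) (\<lambda>(i, j). ?d (if i = m then Suc m else i) j)"
      by (rule cong_mat) auto
    ultimately show ?thesis
      using True by (simp only: Suc det D_minor_Suc_eq) simp
  next
    case False
    have "?d (?s (Suc m)) j = 0" if "j < m" for j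
      using that by (auto simp: D_entry_def)
    note det_expand_last_row [of m "\<lambda>i j. ?d (?s i) j", OF this]
    moreover have "?d (?s (Suc m)) (Suc m) = - Lpow (\<alpha> n)"
      using False by (simp add: D_entry_def Suc)
    moreover have "?d (?s (Suc m)) m = Lpow (\<alpha> (Suc n)) - 1"
      using False by (simp add: D_entry_def Suc)
    moreover have "mat (Suc m) (Suc m) (\<lambda>(i, j). ?d (?s i) j)
        = mat (Suc m) (Suc m) (\<lambda>(i, j). ?d i j)"
      by (rule cong_mat) auto
    moreover have "mat (Suc m) (Suc m) (\<lambda>(i, j). ?d (?s i) (if j = m then Suc m else j))
        = mat (Suc m) (Suc m) (\<lambda>(i, j). ?d i (if j = m then Suc m else j))"
      by (rule cong_mat) auto
    ultimately show ?thesis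
      using False by (simp only: Suc det D_minor_Suc_eq) simp
  qed
qed


section \<open>Positivity\<close>

primrec D_step :: "nat \<Rightarrow> (nat \<Rightarrow> rat) \<Rightarrow> (nat \<Rightarrow> nat) \<Rightarrow> laurent" where
  "D_step 0 \<alpha> \<kappa> = 1"
| "D_step (Suc n) \<alpha> \<kappa> =
     (\<Sum>k<\<kappa> (Suc n) - 2. Lpow (of_nat k * \<alpha> (Suc n))) * D_det n \<alpha> \<kappa>
     + Lpow (of_nat (\<kappa> (Suc n) - 2) * \<alpha> (Suc n)) * D_step n \<alpha> \<kappa>"

lemma Lpow_mult: "Lpow p * Lpow q = Lpow (p + q)"
  by (simp add: Lpow_def mult_single)

lemma Lpow_0 [simp]: "Lpow 0 = 1"
  by (simp add: Lpow_def)

lemma Lpow_of_nat_mult: "Lpow (of_nat k * q) = Lpow q ^ k"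
  proof (induction k)
  case (Suc k)
  have "Lpow (of_nat (Suc k) * q) = Lpow q * Lpow (of_nat k * q)"
    by (simp add: Lpow_mult distrib_right)
  then show ?case using Suc.IH by simp
qed simp

lemma lookup_Lpow_mult:
  "Poly_Mapping.lookup (Lpow q * f) p = Poly_Mapping.lookup f (p - q)"
proof -
  let ?f = "Poly_Mapping.lookup f"
  have "Poly_Mapping.lookup (Lpow q * f) p
      = Sum_any (\<lambda>l. Poly_Mapping.lookup (Lpow q) l * Sum_any (\<lambda>k. ?f k when p = l + k))"
    by (rule lookup_mult)
  also have "\<dots> = Sum_any (\<lambda>l. Sum_any (\<lambda>k. ?f k when p = l + k) when q = l)"
    by (rule arg_cong [where f = Sum_any])
      (auto simp: Lpow_def lookup_single when_def fun_eq_iff)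
  also have "\<dots> = Sum_any (\<lambda>k. ?f k when p = q + k)"
    by simp
  also have "\<dots> = Sum_any (\<lambda>k. ?f k when p - q = k)"
    by (rule arg_cong [where f = Sum_any]) (auto simp: when_def fun_eq_iff)
  finally show ?thesis by simp
qed

lemma D_det_Suc_eq_add:
  assumes two: "\<And>i. 1 \<le> i \<Longrightarrow> i \<le> r \<Longrightarrow> 2 \<le> \<kappa> i"
    and adj: "\<And>i. 1 \<le> i \<Longrightarrow> i \<le> r \<Longrightarrow> of_nat (\<kappa> i) * \<alpha> i = \<alpha> (i - 1) + \<alpha> (i + 1)"
    and n: "n < r"
  shows "D_det (Suc n) \<alpha> \<kappa> = D_det n \<alpha> \<kappa> + Lpow (\<alpha> (Suc n)) * D_step (Suc n) \<alpha> \<kappa>"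
proof -
  define x where "x = (\<lambda>i. Lpow (\<alpha> i))"
  let ?D = "\<lambda>n. D_det n \<alpha> \<kappa>"
  let ?P = "\<lambda>n. D_minor n \<alpha> \<kappa>"
  let ?G = "\<lambda>n. D_step n \<alpha> \<kappa>"
  have relation: "\<exists>m. \<kappa> (Suc n) = m + 2 \<and> x (Suc (Suc n)) * x n = x (Suc n) ^ (m + 2)"
    if "n < r" for n
  proof -
    obtain m where "\<kappa> (Suc n) = m + 2"
      using two [of "Suc n"] \<open>n < r\<close> le_Suc_ex [of 2 "\<kappa> (Suc n)"] by (auto simp: add.commute)
    moreover have "x (Suc (Suc n)) * x n = x (Suc n) ^ \<kappa> (Suc n)"
      using adj [of "Suc n"] \<open>n < r\<close>
      by (simp add: x_def Lpow_mult add.commute flip: Lpow_of_nat_mult)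
    ultimately show ?thesis by auto
  qed
  have cancel: "Lpow (- \<alpha> i) * x i = 1" for i by (simp add: x_def Lpow_mult)
  have shift: "x (Suc (Suc n)) * ?P n = x (Suc n) ^ (m + 1) * (?D n - ?G n)"
    if "x (Suc n) * ?P n = x n * (?D n - ?G n)"
      and "x (Suc (Suc n)) * x n = x (Suc n) ^ (m + 2)" for n m
  proof -
    have "x (Suc n) * (x (Suc (Suc n)) * ?P n) = x (Suc (Suc n)) * x n * (?D n - ?G n)"
      using that(1) by (simp add: mult.assoc mult.left_commute)
    also have "\<dots> = x (Suc n) * (x (Suc n) ^ (m + 1) * (?D n - ?G n))"
      using that(2) by (simp add: mult.assoc)
    finally have "Lpow (- \<alpha> (Suc n)) * x (Suc n) * (x (Suc (Suc n)) * ?P n)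
        = Lpow (- \<alpha> (Suc n)) * x (Suc n) * (x (Suc n) ^ (m + 1) * (?D n - ?G n))"
      by (simp only: mult.assoc)
    then show ?thesis using cancel [of "Suc n"] by simp
  qed
  have key: "x (Suc n) * ?P n = x n * (?D n - ?G n)" if "n \<le> r" for n
    using that
  proof (induction n)
    case 0
    then show ?case by simp
  next
    case (Suc n)
    then have IH: "x (Suc n) * ?P n = x n * (?D n - ?G n)" by simp
    obtain m where m: "\<kappa> (Suc n) = m + 2" "x (Suc (Suc n)) * x n = x (Suc n) ^ (m + 2)"
      using relation [of n] Suc.prems by auto
    define S where "S = (\<Sum>k<m. x (Suc n) ^ k)"
    have D: "?D (Suc n) = (S + x (Suc n) ^ m + x (Suc n) ^ (m + 1)) * ?D n - x (Suc (Suc n)) * ?P n"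
      by (simp add: D_det_Suc m Lpow_of_nat_mult S_def x_def)
    have G: "?G (Suc n) = S * ?D n + x (Suc n) ^ m * ?G n"
      by (simp add: m Lpow_of_nat_mult S_def x_def)
    have P: "?P (Suc n) = x n * ?D n - (x (Suc n) - 1) * ?P n"
      by (simp add: D_minor_Suc x_def)
    define Q where "Q = x (Suc (Suc n)) * ?P n"
    have Q: "Q = x (Suc n) ^ (m + 1) * (?D n - ?G n)"
      unfolding Q_def by (rule shift [OF IH m(2)])
    have "x (Suc (Suc n)) * ?P (Suc n)
        = x (Suc (Suc n)) * x n * ?D n - (x (Suc n) - 1) * Q"
      unfolding P Q_def by (simp add: algebra_simps)
    also have "\<dots> = x (Suc n) ^ (m + 2) * ?D n - x (Suc n) * Q
        + x (Suc n) ^ (m + 1) * (?D n - ?G n)"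
      unfolding m(2) Q [symmetric] by (simp add: algebra_simps)
    also have "\<dots> = x (Suc n) * (?D (Suc n) - ?G (Suc n))"
      unfolding D G Q_def [symmetric] by (simp add: algebra_simps Q)
    finally show ?case .
  qed
  obtain m where m: "\<kappa> (Suc n) = m + 2" "x (Suc (Suc n)) * x n = x (Suc n) ^ (m + 2)"
    using relation [OF n] by auto
  define S where "S = (\<Sum>k<m. x (Suc n) ^ k)"
  have S: "x (Suc n) * S = S + x (Suc n) ^ m - 1"
    using power_diff_1_eq [of "x (Suc n)" m] by (simp add: S_def algebra_simps)
  have P: "Lpow (\<alpha> (Suc (Suc n))) * ?P n = x (Suc n) ^ (m + 1) * (?D n - ?G n)"
    using shift [OF key m(2)] n by (simp add: x_def)
  have "?D (Suc n) = (S + x (Suc n) ^ m + x (Suc n) ^ (m + 1)) * ?D n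
      - x (Suc n) ^ (m + 1) * (?D n - ?G n)"
    unfolding D_det_Suc P by (simp add: m(1) Lpow_of_nat_mult S_def x_def)
  also have "\<dots> = ?D n + (x (Suc n) * S) * ?D n + x (Suc n) ^ (m + 1) * ?G n"
    unfolding S by (simp add: algebra_simps)
  also have "\<dots> = ?D n + x (Suc n) * (S * ?D n + x (Suc n) ^ m * ?G n)"
    by (simp add: algebra_simps)
  also have "S * ?D n + x (Suc n) ^ m * ?G n = ?G (Suc n)"
    by (simp add: m(1) Lpow_of_nat_mult S_def x_def)
  finally show ?thesis by (simp only: x_def)
qed

lemma lookup_D_step_Suc:
  "Poly_Mapping.lookup (D_step (Suc n) \<alpha> \<kappa>) q
    = (\<Sum>k<\<kappa> (Suc n) - 2. Poly_Mapping.lookup (D_det n \<alpha> \<kappa>) (q - of_nat k * \<alpha> (Suc n)))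
      + Poly_Mapping.lookup (D_step n \<alpha> \<kappa>) (q - of_nat (\<kappa> (Suc n) - 2) * \<alpha> (Suc n))"
  by (simp add: lookup_add lookup_Lpow_mult sum_distrib_right Poly_Mapping.lookup_sum)

context
  fixes \<alpha> :: "nat \<Rightarrow> rat" and \<kappa> :: "nat \<Rightarrow> nat" and r :: nat
  assumes two: "\<And>i. 1 \<le> i \<Longrightarrow> i \<le> r \<Longrightarrow> 2 \<le> \<kappa> i"
    and adj: "\<And>i. 1 \<le> i \<Longrightarrow> i \<le> r \<Longrightarrow> of_nat (\<kappa> i) * \<alpha> i = \<alpha> (i - 1) + \<alpha> (i + 1)"
begin

lemma lookup_D_det_Suc:
  assumes "n < r"
  shows "Poly_Mapping.lookup (D_det (Suc n) \<alpha> \<kappa>) q = Poly_Mapping.lookup (D_det n \<alpha> \<kappa>) q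
    + Poly_Mapping.lookup (D_step (Suc n) \<alpha> \<kappa>) (q - \<alpha> (Suc n))"
  by (simp only: D_det_Suc_eq_add [of r, OF two adj assms] lookup_add lookup_Lpow_mult)

lemma D_det_D_step_nonneg:
  assumes "n \<le> r"
  shows "(\<forall>q. 0 \<le> Poly_Mapping.lookup (D_det n \<alpha> \<kappa>) q)
    \<and> (\<forall>q. 0 \<le> Poly_Mapping.lookup (D_step n \<alpha> \<kappa>) q)"
  using assms
proof (induction n)
  case 0
  then show ?case by (simp add: lookup_one when_def)
next
  case (Suc n)
  then have "0 \<le> Poly_Mapping.lookup (D_step (Suc n) \<alpha> \<kappa>) q" for q
    unfolding lookup_D_step_Suc by (simp add: sum_nonneg)
  then show ?case using Suc by (simp add: lookup_D_det_Suc del: D_step.simps)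
qed

lemma D_det_constant_term_pos:
  assumes "n \<le> r"
  shows "0 < Poly_Mapping.lookup (D_det n \<alpha> \<kappa>) 0"
  using assms
proof (induction n)
  case 0
  then show ?case by (simp add: lookup_one)
next
  case (Suc n)
  then show ?case
    using D_det_D_step_nonneg [of "Suc n"]
    by (simp add: lookup_D_det_Suc add_pos_nonneg del: D_step.simps)
qed

lemma D_det_D_step_positive_exponents:
  assumes "n \<le> r" and pos: "\<And>i. 1 \<le> i \<Longrightarrow> i \<le> r \<Longrightarrow> 0 < \<alpha> i"
  shows "Poly_Mapping.lookup (D_det n \<alpha> \<kappa>) 0 = 1
    \<and> (\<forall>q<0. Poly_Mapping.lookup (D_det n \<alpha> \<kappa>) q = 0)
    \<and> (\<forall>q<0. Poly_Mapping.lookup (D_step n \<alpha> \<kappa>) q = 0)"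
  using assms(1)
proof (induction n)
  case 0
  then show ?case by (simp add: lookup_one when_def)
next
  case (Suc n)
  have p: "0 < \<alpha> (Suc n)" using pos Suc.prems by simp
  have neg: "q - of_nat k * \<alpha> (Suc n) < 0" if "q < 0" for q k
  proof -
    have "0 \<le> of_nat k * \<alpha> (Suc n)" using p by simp
    then show ?thesis using that by linarith
  qed
  have step: "Poly_Mapping.lookup (D_step (Suc n) \<alpha> \<kappa>) q = 0" if "q < 0" for q
    unfolding lookup_D_step_Suc using Suc neg [OF that] by simp
  moreover have "q - \<alpha> (Suc n) < 0" if "q \<le> 0" for q
    using that p by linarith
  ultimately show ?case using Suc by (simp add: lookup_D_det_Suc del: D_step.simps)
qed

end

theorem theorem5p10:
  fixes \<pi> :: "'x \<Rightarrow> 's"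
    and T :: "'x set set"
    and genus :: "'x set \<Rightarrow> nat"
    and selfint :: "'x set \<Rightarrow> int"
    and a :: "'x set \<Rightarrow> rat"
    and C :: "nat \<Rightarrow> 'x set"
    and r lo hi :: nat
    and \<alpha> :: "nat \<Rightarrow> rat"
    and \<kappa> :: "nat \<Rightarrow> nat"
    and D :: laurent
  assumes "minimal_log_resolution \<pi> T genus selfint"
    and "log_discrepancies T genus selfint a"
    and "\<forall>s. \<not> strictly_log_canonical_at \<pi> T a s"
    and "exceptional_chain T genus r lo hi C"
    and "\<alpha> = chain_discrepancy a lo hi C"
    and "\<alpha> 0 * \<alpha> (r + 1) \<noteq> 0"
    and "\<kappa> = (\<lambda>i. nat (- selfint (C i)))"
    and "D = D_det r \<alpha> \<kappa>"
  shows "(\<forall>q. Poly_Mapping.lookup D q \<ge> 0) \<and>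
         Poly_Mapping.lookup D 0 > 0 \<and>
         ((\<forall>i\<in>{0..r + 1}. \<alpha> i > 0) \<longrightarrow> Poly_Mapping.lookup D 0 = 1)"
proof -
  interpret minimal_log_resolution \<pi> T genus selfint by fact
  have kap: "2 \<le> \<kappa> i \<and> of_nat (\<kappa> i) * \<alpha> i = \<alpha> (i - 1) + \<alpha> (i + 1)"
    if i: "1 \<le> i" "i \<le> r" for i
  proof -
    have ir: "i \<in> {1..r}" using i by simp
    have le: "selfint (C i) \<le> - 2" by (rule chain_selfint_le [OF assms(4) ir])
    then have k: "(of_nat (\<kappa> i) :: rat) = of_int (- selfint (C i))"
      using assms(7) by simp
    show ?thesis
      using le chain_adjunction [OF assms(2,4) ir] assms(7) unfolding k assms(5) by simp
  qed
  then have two: "\<And>i. 1 \<le> i \<Longrightarrow> i \<le> r \<Longrightarrow> 2 \<le> \<kappa> i"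
    and adj: "\<And>i. 1 \<le> i \<Longrightarrow> i \<le> r \<Longrightarrow> of_nat (\<kappa> i) * \<alpha> i = \<alpha> (i - 1) + \<alpha> (i + 1)"
    by blast+
  show ?thesis
    using D_det_D_step_nonneg [of r \<kappa> \<alpha> r, OF two adj]
      D_det_constant_term_pos [of r \<kappa> \<alpha> r, OF two adj]
      D_det_D_step_positive_exponents [of r \<kappa> \<alpha> r, OF two adj]
    unfolding assms(8) by auto
qed

end
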